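(* Let $\mathbf F:\mathbf R^n\to\mathbf R^n$ be a $C^3$ vector field with Jacobian matrix $\nabla\mathbf F(\mathbf x)$, and consider the gentlest ascent dynamics (GAD) for $(\mathbf x,\mathbf v,\mathbf w)\in\mathbf R^n\times\mathbf R^n\times\mathbf R^n$, $$\dot{\mathbf x}=\mathbf F(\mathbf x)-2\frac{(\mathbf F(\mathbf x),\mathbf w)}{(\mathbf w,\mathbf v)}\mathbf v,\qquad \dot{\mathbf v}=(\nabla\mathbf F(\mathbf x))\mathbf v-\alpha\,\mathbf v,\qquad \dot{\mathbf w}=(\nabla\mathbf F(\mathbf x))^T\mathbf w-\beta\,\mathbf w,$$ where $\alpha=(\mathbf v,(\nabla\mathbf F(\mathbf x))\mathbf v)$ and $\beta=2(\mathbf w,(\nabla\mathbf F(\mathbf x))\mathbf v)-\alpha$. Then the following hold. (a) If $(\mathbf x_*,\mathbf v_*,\mathbf w_* )$ is a fixed point of the GAD with $\mathbf v_*^T\mathbf v_*=\mathbf v_*^T\mathbf w_*=1$, then $\mathbf v_*$ and $\mathbf w_*$ are right and left eigenvectors, respectively, of $\nabla\mathbf F(\mathbf x_* )$ for one and the same eigenvalue $\lambda_*$, i.e. there is $\lambda_*\in\mathbf R$ with $$(\nabla\mathbf F(\mathbf x_* ))\mathbf v_*=\lambda_*\mathbf v_*,\qquad (\nabla\mathbf F(\mathbf x_* ))^T\mathbf w_*=\lambda_*\mathbf w_*,$$ and $\mathbf x_*$ is a fixed point of the original system $\dot{\mathbf x}=\mathbf F(\mathbf x)$, i.e. $\mathbf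 F(\mathbf x_* )=\mathbf 0$. (b) Let $\mathbf x_s$ be a fixed point of $\dot{\mathbf x}=\mathbf F(\mathbf x)$, i.e. $\mathbf F(\mathbf x_s)=\mathbf 0$. Suppose that the Jacobian $\mathbb J(\mathbf x_s)=\nabla\mathbf F(\mathbf x_s)$ has $n$ distinct real eigenvalues $\lambda_1,\dots,\lambda_n$, with $n$ linearly independent right eigenvectors $\mathbf v_1,\dots,\mathbf v_n$ and $n$ linearly independent left eigenvectors $\mathbf w_1,\dots,\mathbf w_n$, that is, $$\mathbb J(\mathbf x_s)\mathbf v_i=\lambda_i\mathbf v_i,\qquad \mathbb J(\mathbf x_s)^T\mathbf w_i=\lambda_i\mathbf w_i,\qquad i=1,\dots,n,$$ normalized so that $\mathbf v_i^T\mathbf v_i=\mathbf w_i^T\mathbf v_i=1$ for all $i$. Then for every $i=1,\dots,n$, $(\mathbf x_s,\mathbf v_i,\mathbf w_i)$ is a fixed point of the GAD. Furthermore, for $i'\in\{1,\dots,n\}$, the fixed point $(\mathbf x_s,\mathbf v_{i'},\mathbf w_{i'})$ is a linearly stable fixed point of the GAD if and only if $\mathbf x_s$ is an index-$1$ saddle point of $\dot{\mathbf x}=\mathbf F(\mathbf x)$ and $\lambda_{i'}$ is the only positive eigenvalue of $\mathbb J(\mathbf x_s)$. In particular, one of these $n$ fixed points is linearly stable if and only if $\mathbf x_s$ is an index-$1$ saddle point of $\dot{\mathbf x}=\mathbf F(\mathbf x)$.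
   Context: $(\cdot,\cdot)$ is the Euclidean inner product on $\mathbf R^n$. The Jacobian $\nabla\mathbf F(\mathbf x)$ is the $n\times n$ matrix with $(i,j)$ entry $\partial F_i/\partial x_j$. The GAD is regarded as an autonomous ODE on the open set $\{(\mathbf x,\mathbf v,\mathbf w)\in\mathbf R^{3n}:(\mathbf w,\mathbf v)\neq 0\}$; a fixed point is a zero of its right-hand side. A fixed point of an ODE is linearly stable if all eigenvalues of the Jacobian matrix of the right-hand side at that point (for the GAD, a $3n\times 3n$ matrix, with respect to all variables $(\mathbf x,\mathbf v,\mathbf w)$) have negative real part. A fixed point $\mathbf x_s$ of $\dot{\mathbf x}=\mathbf F(\mathbf x)$ is an index-$1$ saddle point if exactly one eigenvalue of $\nabla\mathbf F(\mathbf x_s)$ has positive real part and all the other eigenvalues have negative real part. *)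

theory Defs
  imports "HOL-Analysis.Analysis" "HOL-Computational_Algebra.Polynomial"
begin

(* Iterated directional derivatives in all directions exist and are continuous; in finite
   dimension this is equivalent to continuity of all partial derivatives up to order k. *)
primrec C_k :: "nat \<Rightarrow> ('a::real_normed_vector \<Rightarrow> 'b::real_normed_vector) \<Rightarrow> bool" where
  "C_k 0 f \<longleftrightarrow> continuous_on UNIV f"
| "C_k (Suc k) f \<longleftrightarrow>
     (\<forall>x. f differentiable (at x)) \<and> (\<forall>h. C_k k (\<lambda>x. frechet_derivative f (at x) h))"

definition eigenvector :: "'a::field^'n^'n \<Rightarrow> 'a \<Rightarrow> 'a^'n \<Rightarrow> bool" where
  "eigenvector A c v \<longleftrightarrow> v \<noteq> 0 \<and> A *v v = c *s v"

definition left_eigenvector :: "'a::field^'n^'n \<Rightarrow> 'a \<Rightarrow> 'a^'n \<Rightarrow> bool" where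
  "left_eigenvector A c w \<longleftrightarrow> eigenvector (transpose A) c w"

definition eigenvalue :: "'a::field^'n^'n \<Rightarrow> 'a \<Rightarrow> bool" where
  "eigenvalue A c \<longleftrightarrow> (\<exists>v. eigenvector A c v)"

definition charpoly :: "'a::field^'n^'n \<Rightarrow> 'a poly" where
  "charpoly A = det (mat [:0, 1:] - map_matrix (\<lambda>a. [:a:]) A)"

definition complex_matrix :: "real^'n^'n \<Rightarrow> complex^'n^'n" where
  "complex_matrix A = map_matrix complex_of_real A"

(* The autonomous ODE z' = G z on the open set D. *)
definition fixed_point :: "(real^'m) set \<Rightarrow> (real^'m \<Rightarrow> real^'m) \<Rightarrow> real^'m \<Rightarrow> bool" where
  "fixed_point D G z \<longleftrightarrow> z \<in> D \<and> G z = 0"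

(* jacobian G (at z) is meaningful only where G is differentiable; G is meant to be
   continuously differentiable on D here and in index1_saddle. *)
definition linearly_stable :: "(real^'m) set \<Rightarrow> (real^'m \<Rightarrow> real^'m) \<Rightarrow> real^'m \<Rightarrow> bool" where
  "linearly_stable D G z \<longleftrightarrow> fixed_point D G z \<and>
     (\<forall>\<mu>. eigenvalue (complex_matrix (jacobian G (at z))) \<mu> \<longrightarrow> Re \<mu> < 0)"

(* Eigenvalues are counted with algebraic multiplicity, so the one with positive real part
   is a simple root of the characteristic polynomial. *)
definition index1_saddle :: "(real^'m) set \<Rightarrow> (real^'m \<Rightarrow> real^'m) \<Rightarrow> real^'m \<Rightarrow> bool" where
  "index1_saddle D G z \<longleftrightarrow> fixed_point D G z \<and>
     (let A = complex_matrix (jacobian G (at z)) in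
       \<exists>\<mu>. eigenvalue A \<mu> \<and> Re \<mu> > 0 \<and> order \<mu> (charpoly A) = 1 \<and>
         (\<forall>\<nu>. eigenvalue A \<nu> \<and> \<nu> \<noteq> \<mu> \<longrightarrow> Re \<nu> < 0))"

(* R^3n is the space of vectors indexed by three disjoint copies of the index type of R^n. *)
definition join3 :: "real^'n \<Rightarrow> real^'n \<Rightarrow> real^'n \<Rightarrow> real^('n::finite + 'n + 'n)" where
  "join3 x v w = (\<chi> k. case k of Inl i \<Rightarrow> x $ i | Inr (Inl i) \<Rightarrow> v $ i | Inr (Inr i) \<Rightarrow> w $ i)"

definition x_part :: "real^('n::finite + 'n + 'n) \<Rightarrow> real^'n" where
  "x_part z = (\<chi> i. z $ Inl i)"

definition v_part :: "real^('n::finite + 'n + 'n) \<Rightarrow> real^'n" where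
  "v_part z = (\<chi> i. z $ Inr (Inl i))"

definition w_part :: "real^('n::finite + 'n + 'n) \<Rightarrow> real^'n" where
  "w_part z = (\<chi> i. z $ Inr (Inr i))"

lemma parts_join3 [simp]:
  "x_part (join3 x v w) = x" "v_part (join3 x v w) = v" "w_part (join3 x v w) = w"
  by (simp_all add: x_part_def v_part_def w_part_def join3_def vec_eq_iff)

lemma join3_parts [simp]: "join3 (x_part z) (v_part z) (w_part z) = z"
  by (auto simp: x_part_def v_part_def w_part_def join3_def vec_eq_iff split: sum.split)

definition gad_domain :: "(real^('n::finite + 'n + 'n)) set" where
  "gad_domain = {z. w_part z \<bullet> v_part z \<noteq> 0}"

definition gad :: "(real^'n \<Rightarrow> real^'n) \<Rightarrow> real^('n::finite + 'n + 'n) \<Rightarrow> real^('n::finite + 'n + 'n)" where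
  "gad F z =
     (let x = x_part z; v = v_part z; w = w_part z;
          J = jacobian F (at x);
          \<alpha> = v \<bullet> (J *v v);
          \<beta> = 2 * (w \<bullet> (J *v v)) - \<alpha>
      in join3 (F x - (2 * ((F x \<bullet> w) / (w \<bullet> v))) *\<^sub>R v)
               (J *v v - \<alpha> *\<^sub>R v)
               (transpose J *v w - \<beta> *\<^sub>R w))"

end

theory Submission
  imports Defs
begin

text \<open>
  At a zero of F the linearization of the GAD at (x, v i, w i) is block lower triangular in
  (x, v, w). Its diagonal blocks are triangular in the eigenbases v j, v j, w j, with diagonal
  entries lam j (j \<noteq> i) and - lam i; lam j - lam i (j \<noteq> i) and - 2 * lam i; and the latter list again.
  All of these are negative iff lam i is positive and every other lam j is negative, and, the
  spectrum being simple, this is the index-1 condition with lam i as the positive eigenvalue.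
  Complex eigenvectors of real matrices are treated as pairs of real vectors, tested against real
  left eigenvectors.
\<close>

section \<open>Eigenvalues of real matrices over the complex numbers\<close>

lemma map_matrix_const_mult:
  fixes A :: "'a::comm_semiring_1^'n^'m" and B :: "'a^'k^'n"
  shows "map_matrix (\<lambda>a. [:a:]) (A ** B) = map_matrix (\<lambda>a. [:a:]) A ** map_matrix (\<lambda>a. [:a:]) B"
proof -
  have "[:\<Sum>k\<in>S. f k:] = (\<Sum>k\<in>S. [:f k:])" for f :: "'n \<Rightarrow> 'a" and S
    by (rule poly_eqI) (simp add: coeff_sum coeff_pCons split: nat.split)
  then show ?thesis
    by (simp add: vec_eq_iff matrix_matrix_mult_def mult.commute[where 'a='a])
qed

lemma matrix_diff_rdistrib:
  fixes A B :: "'a::ring_1^'n^'m"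
  shows "(A - B) ** C = A ** C - B ** C"
  by (simp add: matrix_matrix_mult_def vec_eq_iff left_diff_distrib sum_subtractf)

lemma matrix_diff_ldistrib:
  fixes A :: "'a::ring_1^'n^'m"
  shows "A ** (B - C) = A ** B - A ** C"
  by (simp add: matrix_matrix_mult_def vec_eq_iff right_diff_distrib sum_subtractf)

text \<open>Conjugation is carried out over the polynomial ring: constant polynomials turn
  \<open>UV\<close> into a product of polynomial matrices equal to the identity, so the determinant
  of the embedded \<open>V\<close> is nonzero and cancels in this integral domain. The factorization
  serves the multiplicity clause of \<open>index1_saddle\<close>.\<close>

lemma charpoly_diagonalizable:
  fixes A V U :: "'a::field^'n^'n"
  assumes AV: "A ** V = V ** (\<chi> i j. if i = j then d i else 0)" and UV: "U ** V = mat 1"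
  shows "charpoly A = (\<Prod>i\<in>UNIV. [:- d i, 1:])"
proof -
  let ?c = "map_matrix (\<lambda>a::'a. [:a:])"
  let ?D = "(\<chi> i j. if i = j then d i else 0) :: 'a^'n^'n"
  let ?E = "(\<chi> i j. if i = j then [:- d i, 1:] else 0) :: 'a poly^'n^'n"
  have "?c U ** ?c V = mat 1"
    by (simp flip: map_matrix_const_mult add: UV) (simp add: vec_eq_iff mat_def)
  then have "det (?c U) * det (?c V) = 1"
    by (metis det_I det_mul)
  then have nz: "det (?c V) \<noteq> 0"
    by auto
  have E: "?E = mat [:0, 1:] - ?c ?D"
    by (simp add: vec_eq_iff mat_def)
  have comm: "mat [:0, 1:] ** ?c V = ?c V ** mat [:0, 1:]"
    by (simp add: vec_eq_iff matrix_matrix_mult_def mat_def if_distrib if_distribR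
        cong: if_cong)
  have "(mat [:0, 1:] - ?c A) ** ?c V = mat [:0, 1:] ** ?c V - ?c A ** ?c V"
    by (rule matrix_diff_rdistrib)
  also have "\<dots> = ?c V ** mat [:0, 1:] - ?c V ** ?c ?D"
    unfolding comm map_matrix_const_mult[symmetric] AV ..
  also have "\<dots> = ?c V ** ?E"
    unfolding E by (rule matrix_diff_ldistrib[symmetric])
  finally have "det ((mat [:0, 1:] - ?c A) ** ?c V) = det (?c V ** ?E)"
    by (rule arg_cong)
  then have "charpoly A * det (?c V) = det (?c V) * det ?E"
    unfolding charpoly_def det_mul .
  then have "charpoly A = det ?E"
    using nz by simp
  also have "\<dots> = (\<Prod>i\<in>UNIV. [:- d i, 1:])"
    by (subst det_diagonal) auto
  finally show ?thesis .
qed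

text \<open>Once the factor of \<open>d i\<close> is split off, injectivity keeps the remaining
  product nonzero at \<open>d i\<close>, so only that one factor contributes to the order.\<close>

lemma order_prod_distinct_linear:
  fixes d :: "'n::finite \<Rightarrow> 'a::field"
  assumes "inj d"
  shows "order (d i) (\<Prod>j\<in>UNIV. [:- d j, 1:]) = 1"
proof -
  have split: "(\<Prod>j\<in>UNIV. [:- d j, 1:]) = [:- d i, 1:] * (\<Prod>j\<in>UNIV - {i}. [:- d j, 1:])"
    by (rule prod.remove) auto
  have nz: "poly (\<Prod>j\<in>UNIV - {i}. [:- d j, 1:]) (d i) \<noteq> 0"
    using injD[OF assms] by (auto simp: poly_prod)
  then have "[:- d i, 1:] * (\<Prod>j\<in>UNIV - {i}. [:- d j, 1:]) \<noteq> 0"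
    by (metis mult_eq_0_iff pCons_eq_0_iff poly_0 zero_neq_one)
  then have "order (d i) (\<Prod>j\<in>UNIV. [:- d j, 1:]) =
      order (d i) [:- d i, 1:] + order (d i) (\<Prod>j\<in>UNIV - {i}. [:- d j, 1:])"
    unfolding split by (rule order_mult)
  moreover have "order (d i) [:- d i, 1:] = 1"
    using order_power_n_n[of "d i" 1] by simp
  ultimately show ?thesis
    using order_0I[OF nz] by simp
qed

text \<open>These are the real and imaginary parts of M z = mu z for z = p + iq. In this form
  complex eigenvalues can be studied with the real inner product alone.\<close>

lemma eigenvalue_complex_matrix_iff:
  fixes M :: "real^'m^'m"
  shows "eigenvalue (complex_matrix M) \<mu> \<longleftrightarrow>
    (\<exists>p q. (p \<noteq> 0 \<or> q \<noteq> 0) \<and> M *v p = Re \<mu> *\<^sub>R p - Im \<mu> *\<^sub>R q \<and> M *v q = Im \<mu> *\<^sub>R p + Re \<mu> *\<^sub>R q)"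
proof
  assume "eigenvalue (complex_matrix M) \<mu>"
  then obtain z where z: "z \<noteq> 0" "complex_matrix M *v z = \<mu> *s z"
    by (auto simp: eigenvalue_def eigenvector_def)
  let ?p = "\<chi> k. Re (z $ k)" and ?q = "\<chi> k. Im (z $ k)"
  have "?p \<noteq> 0 \<or> ?q \<noteq> 0"
    using z(1) by (auto simp: vec_eq_iff complex_eq_iff)
  moreover have "(complex_matrix M *v z) $ k = \<mu> * z $ k" for k
    by (simp add: z(2))
  then have "Re ((complex_matrix M *v z) $ k) = Re (\<mu> * z $ k)"
      "Im ((complex_matrix M *v z) $ k) = Im (\<mu> * z $ k)" for k
    by simp_all
  then have "M *v ?p = Re \<mu> *\<^sub>R ?p - Im \<mu> *\<^sub>R ?q \<and> M *v ?q = Im \<mu> *\<^sub>R ?p + Re \<mu> *\<^sub>R ?q"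
    by (simp add: vec_eq_iff matrix_vector_mult_def complex_matrix_def algebra_simps)
  ultimately show "\<exists>p q. (p \<noteq> 0 \<or> q \<noteq> 0) \<and> M *v p = Re \<mu> *\<^sub>R p - Im \<mu> *\<^sub>R q \<and>
      M *v q = Im \<mu> *\<^sub>R p + Re \<mu> *\<^sub>R q"
    by blast
next
  assume "\<exists>p q. (p \<noteq> 0 \<or> q \<noteq> 0) \<and> M *v p = Re \<mu> *\<^sub>R p - Im \<mu> *\<^sub>R q \<and>
      M *v q = Im \<mu> *\<^sub>R p + Re \<mu> *\<^sub>R q"
  then obtain p q where pq: "p \<noteq> 0 \<or> q \<noteq> 0"
      "M *v p = Re \<mu> *\<^sub>R p - Im \<mu> *\<^sub>R q" "M *v q = Im \<mu> *\<^sub>R p + Re \<mu> *\<^sub>R q"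
    by blast
  let ?z = "\<chi> k. Complex (p $ k) (q $ k)"
  have "?z \<noteq> 0"
    using pq(1) by (auto simp: vec_eq_iff complex_eq_iff)
  moreover have "complex_matrix M *v ?z = \<mu> *s ?z"
    using pq(2,3) by (simp add: vec_eq_iff matrix_vector_mult_def complex_matrix_def
        complex_eq_iff algebra_simps)
  ultimately show "eigenvalue (complex_matrix M) \<mu>"
    unfolding eigenvalue_def eigenvector_def by blast
qed

lemma eigenvalue_complex_matrix_of_real:
  fixes M :: "real^'m^'m"
  assumes "eigenvalue M r"
  shows "eigenvalue (complex_matrix M) (complex_of_real r)"
proof -
  obtain p where "p \<noteq> 0" "M *v p = r *\<^sub>R p"
    using assms by (auto simp: eigenvalue_def eigenvector_def scalar_mult_eq_scaleR)
  then show ?thesis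
    unfolding eigenvalue_complex_matrix_iff by (intro exI[of _ p] exI[of _ 0]) simp
qed

text \<open>The hypothesis makes \<open>l\<close> orthogonal to the range of M - r I. If
  \<open>r\<close> were not an eigenvalue, that range would be the whole space and \<open>l\<close>
  would be orthogonal to itself. For a block lower triangular matrix, left eigenvectors of the first
  block extend by zeros, whereas right eigenvectors would require solving for the lower
  components.\<close>

lemma eigenvalue_from_left:
  fixes M :: "real^'m^'m"
  assumes "l \<noteq> 0" and l: "\<And>x. l \<bullet> (M *v x) = r * (l \<bullet> x)"
  shows "eigenvalue M r"
proof (rule ccontr)
  assume "\<not> eigenvalue M r"
  then have "x = 0" if "M *v x = r *\<^sub>R x" for x
    using that by (metis eigenvalue_def eigenvector_def scalar_mult_eq_scaleR)
  moreover have shift: "(M - r *\<^sub>R mat 1) *v x = M *v x - r *\<^sub>R x" for x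
    by (simp add: matrix_vector_mult_diff_rdistrib flip: scaleR_matrix_vector_assoc)
  ultimately have "\<forall>x. (M - r *\<^sub>R mat 1) *v x = 0 \<longrightarrow> x = 0"
    by simp
  then obtain B where "B ** (M - r *\<^sub>R mat 1) = mat 1"
    using matrix_left_invertible_ker by blast
  then have "(M - r *\<^sub>R mat 1) ** B = mat 1"
    using matrix_left_right_inverse by blast
  then have "(M - r *\<^sub>R mat 1) *v (B *v l) = l"
    by (metis matrix_vector_mul_assoc matrix_vector_mul_lid)
  moreover have "l \<bullet> ((M - r *\<^sub>R mat 1) *v x) = 0" for x
    by (simp add: shift inner_diff_right l)
  ultimately have "l \<bullet> l = 0"
    by metis
  with assms(1) show False
    by simp
qed

text \<open>With mu = s + it, the hypotheses say (r - mu)(P + iQ) = 0. Here \<open>P\<close> and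
  \<open>Q\<close> are the values of a real left eigenvector for \<open>r\<close> on the real and
  imaginary parts of an eigenvector for mu.\<close>

lemma left_functional_dichotomy:
  fixes P Q s t r :: real
  assumes "r * P = s * P - t * Q" "r * Q = t * P + s * Q"
  shows "s = r \<and> t = 0 \<or> P = 0 \<and> Q = 0"
proof -
  have "(r - s) * P = - t * Q" "(r - s) * Q = t * P"
    using assms by (simp_all add: algebra_simps)
  \<comment> \<open>Multiplying by r - s once more and substituting the other equation produces the
    factor |r - mu|^2 in front of \<open>P\<close> and of \<open>Q\<close>.\<close>
  then have "(r - s) * ((r - s) * P) = - (t * (t * P))" "(r - s) * ((r - s) * Q) = - (t * (t * Q))"
    by (metis mult.commute mult.left_commute mult_minus_left)+
  then have "((r - s)\<^sup>2 + t\<^sup>2) * P = 0" "((r - s)\<^sup>2 + t\<^sup>2) * Q = 0"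
    by (simp_all add: power2_eq_square algebra_simps)
  then show ?thesis
    by (auto simp: sum_power2_eq_zero_iff)
qed

text \<open>As many independent vectors as the dimension span the space, so \<open>p\<close> is
  orthogonal to itself.\<close>

lemma orthogonal_family_zero:
  fixes w :: "'n \<Rightarrow> real^'n"
  assumes "inj w" "independent (range w)" and "\<And>j. w j \<bullet> p = 0"
  shows "p = 0"
proof -
  have "UNIV \<subseteq> span (range w)"
    using assms(1,2) by (intro card_ge_dim_independent) (auto simp: card_image)
  then have "orthogonal p p"
    using assms(3) by (intro orthogonal_to_span[of p "range w"])
      (auto simp: orthogonal_def inner_commute)
  then show ?thesis
    by (simp add: orthogonal_def)
qed

section \<open>The linearization of the GAD\<close>

lemma has_derivative_join3:
  assumes "(f has_derivative f') (at z)" "(g has_derivative g') (at z)" "(h has_derivative h') (at z)"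
  shows "((\<lambda>z. join3 (f z) (g z) (h z)) has_derivative (\<lambda>d. join3 (f' d) (g' d) (h' d))) (at z)"
proof -
  have comp: "((\<lambda>z. u z $ k) has_derivative (\<lambda>d. u' d $ k)) (at z)"
    if "(u has_derivative u') (at z)" for u :: "'a \<Rightarrow> real^'b" and u' k
    using bounded_linear.has_derivative[OF bounded_linear_vec_nth that] .
  have "((\<lambda>z. join3 (f z) (g z) (h z) $ k) has_derivative (\<lambda>d. join3 (f' d) (g' d) (h' d) $ k)) (at z)" for k
    \<comment> \<open>The first split separates the x block from the others, the second separates v
      from w. On an \<open>Inl\<close> index the value of \<open>projr\<close> is arbitrary and the
      extra split is harmless.\<close>
    by (cases k; (cases "projr k")?) (auto simp: join3_def intro!: comp assms split: sum.splits)
  then show ?thesis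
    by (subst has_derivative_componentwise_within) (auto simp: Basis_vec_def inner_axis)
qed

lemma bounded_linear_parts:
  "bounded_linear x_part" "bounded_linear v_part" "bounded_linear w_part"
  by (auto simp flip: linear_conv_bounded_linear
      simp: linear_iff vec_eq_iff x_part_def v_part_def w_part_def)

lemma join3_zero: "join3 0 0 0 = 0"
  by (simp add: join3_def vec_eq_iff split: sum.split)

lemma inner_join3:
  "join3 a b c \<bullet> z = a \<bullet> x_part z + b \<bullet> v_part z + c \<bullet> w_part z"
proof -
  have sum_Plus: "(\<Sum>k\<in>UNIV. g k) = (\<Sum>i\<in>UNIV. g (Inl i)) + (\<Sum>i\<in>UNIV. g (Inr i))"
    for g :: "'x::finite + 'y::finite \<Rightarrow> real"
    by (simp flip: UNIV_Plus_UNIV add: sum.Plus)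
  show ?thesis
    by (simp add: sum_Plus inner_vec_def join3_def x_part_def v_part_def w_part_def)
qed

text \<open>
  H and K collect the second derivatives of F; they enter only below the diagonal blocks, so
  vanishing at 0 is all that is needed of them.
\<close>
lemma gad_has_derivative_at_eigenvectors:
  fixes F :: "real^'n \<Rightarrow> real^'n" and x v w :: "real^'n"
  defines "J \<equiv> jacobian F (at x)"
  assumes F: "C_k 3 F" and F0: "F x = 0"
    and Jv: "J *v v = l *\<^sub>R v" and Jw: "transpose J *v w = l *\<^sub>R w"
    and vv: "v \<bullet> v = 1" and wv: "w \<bullet> v = 1"
  obtains H K :: "real^'n \<Rightarrow> real^'n" where "H 0 = 0" "K 0 = 0"
    "(gad F has_derivative (\<lambda>d. join3
        (J *v x_part d - (2 * l * (w \<bullet> x_part d)) *\<^sub>R v)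
        (H (x_part d) + J *v v_part d - (l * (v_part d \<bullet> v) + v \<bullet> (J *v v_part d)) *\<^sub>R v - l *\<^sub>R v_part d)
        (K (x_part d) - (2 * l * (w \<bullet> v_part d) - l * (v_part d \<bullet> v) - v \<bullet> (J *v v_part d)) *\<^sub>R w
          + transpose J *v w_part d - (2 * l * (w_part d \<bullet> v)) *\<^sub>R w - l *\<^sub>R w_part d)))
      (at (join3 x v w))"
proof -
  let ?z = "join3 x v w"
  \<comment> \<open>\<open>D k\<close> is the k-th column of the Jacobian. Expanding both matrix
    products in these columns (\<open>J_sum\<close>, \<open>Jt_sum\<close>) reduces differentiation
    of a matrix-valued map to that of finitely many vector fields.\<close>
  define D where "D k y = frechet_derivative F (at y) (axis k 1)" for k y
  have C: "F differentiable (at y)" "C_k 2 (\<lambda>y. frechet_derivative F (at y) h)" for y h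
    using F by (auto simp: numeral_3_eq_3 numeral_2_eq_2)
  have "D k differentiable (at x)" for k
    using C(2)[of "axis k 1"] by (simp add: numeral_2_eq_2 D_def[abs_def])
  then obtain D' where D': "(D k has_derivative D' k) (at x)" for k
    unfolding differentiable_def by metis
  have D'0: "D' k 0 = 0" for k
    using has_derivative_linear[OF D'] by (rule linear_0)
  have J_axis: "jacobian F (at y) *v axis k 1 = D k y" for y k
    using frechet_derivative_at[OF C(1)[of y, unfolded jacobian_works]] by (simp add: D_def fun_eq_iff)
  have J_sum: "jacobian F (at y) *v u = (\<Sum>k\<in>UNIV. u $ k *\<^sub>R D k y)" for y u
    unfolding J_axis[symmetric] matrix_vector_mult_basis
    by (simp add: matrix_mult_sum scalar_mult_eq_scaleR)
  have Jt_sum: "transpose (jacobian F (at y)) *v u = (\<Sum>k\<in>UNIV. (u \<bullet> D k y) *\<^sub>R axis k 1)" for y u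
  proof -
    have "(transpose (jacobian F (at y)) *v u) $ k = u \<bullet> D k y" for k
      by (metis J_axis dot_lmul_matrix inner_axis inner_real_def mult.right_neutral transpose_matrix_vector)
    then show ?thesis
      by (simp add: vec_eq_iff axis_def if_distrib cong: if_cong)
  qed
  note parts [derivative_intros] = bounded_linear.has_derivative[OF bounded_linear_parts(1)]
    bounded_linear.has_derivative[OF bounded_linear_parts(2)]
    bounded_linear.has_derivative[OF bounded_linear_parts(3)]
  have F': "((\<lambda>z. F (x_part z)) has_derivative (\<lambda>d. J *v x_part d)) (at ?z)"
    by (rule has_derivative_compose[of x_part x_part _ _ F])
      (use C(1) in \<open>auto intro!: derivative_eq_intros simp: J_def jacobian_works\<close>)
  have D_comp: "((\<lambda>z. D k (x_part z)) has_derivative (\<lambda>d. D' k (x_part d))) (at ?z)" for k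
    by (rule has_derivative_compose[of x_part x_part _ _ "D k"])
      (auto intro!: derivative_eq_intros D')
  define H where "H a = (\<Sum>k\<in>UNIV. v $ k *\<^sub>R D' k a)" for a
  define K where "K a = (\<Sum>k\<in>UNIV. (w \<bullet> D' k a) *\<^sub>R (axis k 1 :: real^'n))" for a
  let ?P = "\<lambda>z. jacobian F (at (x_part z)) *v v_part z"
  let ?Q = "\<lambda>z. transpose (jacobian F (at (x_part z))) *v w_part z"
  have P': "(?P has_derivative (\<lambda>d. H (x_part d) + J *v v_part d)) (at ?z)"
    unfolding J_sum J_def H_def
    by (auto intro!: derivative_eq_intros D_comp bounded_linear.has_derivative[OF bounded_linear_vec_nth]
        simp: sum.distrib)
  have Q': "(?Q has_derivative (\<lambda>d. K (x_part d) + transpose J *v w_part d)) (at ?z)"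
    unfolding Jt_sum J_def K_def
    by (auto intro!: derivative_eq_intros D_comp simp: sum.distrib scaleR_add_left)
  have [simp]: "jacobian F (at x) = J"
    by (simp add: J_def)
  have wJ: "w \<bullet> (J *v u) = l * (w \<bullet> u)" for u
    using Jw by (metis dot_lmul_matrix inner_scaleR_left transpose_matrix_vector)
  have vw: "v \<bullet> w = 1"
    using wv by (simp add: inner_commute)
  \<comment> \<open>Since F vanishes at \<open>x\<close>, only the numerator of the quotient
    contributes to its derivative. Hence the x row has no v or w terms, which starts the block
    triangular shape.\<close>
  have X: "((\<lambda>z. F (x_part z) - (2 * ((F (x_part z) \<bullet> w_part z) / (w_part z \<bullet> v_part z))) *\<^sub>R v_part z)
      has_derivative (\<lambda>d. J *v x_part d - (2 * l * (w \<bullet> x_part d)) *\<^sub>R v)) (at ?z)"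
    by (rule derivative_eq_intros F' refl | simp add: wv)+
      (auto simp: fun_eq_iff F0 wv wJ inner_commute)
  have V: "((\<lambda>z. ?P z - (v_part z \<bullet> ?P z) *\<^sub>R v_part z) has_derivative
      (\<lambda>d. H (x_part d) + J *v v_part d
         - (l * (v_part d \<bullet> v) + v \<bullet> (H (x_part d) + J *v v_part d)) *\<^sub>R v - l *\<^sub>R v_part d)) (at ?z)"
    by (rule derivative_eq_intros P' refl)+
      (auto simp: fun_eq_iff Jv vv wv inner_commute algebra_simps)
  \<comment> \<open>At the base point both alpha and beta equal \<open>l\<close>, because Jv = lv
    and (w, v) = 1.\<close>
  have W: "((\<lambda>z. ?Q z - (2 * (w_part z \<bullet> ?P z) - v_part z \<bullet> ?P z) *\<^sub>R w_part z) has_derivative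
      (\<lambda>d. K (x_part d) + transpose J *v w_part d
         - (2 * (l * (w_part d \<bullet> v) + w \<bullet> H (x_part d) + l * (w \<bullet> v_part d))
            - (l * (v_part d \<bullet> v) + v \<bullet> (H (x_part d) + J *v v_part d))) *\<^sub>R w - l *\<^sub>R w_part d)) (at ?z)"
    by (rule derivative_eq_intros P' Q' refl)+
      (auto simp: fun_eq_iff Jv vv wv vw wJ inner_commute algebra_simps
        simp flip: scaleR_2 scaleR_left_distrib)
  have "gad F = (\<lambda>z. join3
      (F (x_part z) - (2 * ((F (x_part z) \<bullet> w_part z) / (w_part z \<bullet> v_part z))) *\<^sub>R v_part z)
      (?P z - (v_part z \<bullet> ?P z) *\<^sub>R v_part z)
      (?Q z - (2 * (w_part z \<bullet> ?P z) - v_part z \<bullet> ?P z) *\<^sub>R w_part z))"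
    by (simp add: gad_def Let_def fun_eq_iff)
  then have G: "(gad F has_derivative (\<lambda>d. join3
      (J *v x_part d - (2 * l * (w \<bullet> x_part d)) *\<^sub>R v)
      (H (x_part d) + J *v v_part d
         - (l * (v_part d \<bullet> v) + v \<bullet> (H (x_part d) + J *v v_part d)) *\<^sub>R v - l *\<^sub>R v_part d)
      (K (x_part d) + transpose J *v w_part d
         - (2 * (l * (w_part d \<bullet> v) + w \<bullet> H (x_part d) + l * (w \<bullet> v_part d))
            - (l * (v_part d \<bullet> v) + v \<bullet> (H (x_part d) + J *v v_part d))) *\<^sub>R w - l *\<^sub>R w_part d)))
      (at ?z)"
    using has_derivative_join3[OF X V W] by simp
  show ?thesis
  \<comment> \<open>All second-derivative terms, including those from alpha and beta, depend on
    \<open>x_part d\<close> only and are absorbed into the two maps supplied here.\<close>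
  proof (rule that[of "\<lambda>a. H a - (v \<bullet> H a) *\<^sub>R v" "\<lambda>a. K a - (2 * (w \<bullet> H a) - v \<bullet> H a) *\<^sub>R w"])
    show "H 0 - (v \<bullet> H 0) *\<^sub>R v = 0" "K 0 - (2 * (w \<bullet> H 0) - v \<bullet> H 0) *\<^sub>R w = 0"
      by (simp_all add: H_def K_def D'0)
  qed (rule has_derivative_eq_rhs[OF G], simp add: fun_eq_iff algebra_simps)
qed

section \<open>Stability\<close>

locale biorthonormal_eigenbasis =
  fixes J :: "real^'n^'n" and lam :: "'n \<Rightarrow> real" and v w :: "'n \<Rightarrow> real^'n"
  assumes inj_lam: "inj lam"
    and inj_v: "inj v" and indep_v: "independent (range v)"
    and inj_w: "inj w" and indep_w: "independent (range w)"
    and right: "J *v v i = lam i *\<^sub>R v i"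
    and left: "transpose J *v w i = lam i *\<^sub>R w i"
    and v_v: "v i \<bullet> v i = 1" and w_v: "w i \<bullet> v i = 1"
begin

lemma w_J: "w j \<bullet> (J *v u) = lam j * (w j \<bullet> u)"
  using left by (metis dot_lmul_matrix inner_scaleR_left transpose_matrix_vector)

lemma v_Jt: "v j \<bullet> (transpose J *v u) = lam j * (v j \<bullet> u)"
  using right by (metis dot_lmul_matrix inner_scaleR_right inner_commute transpose_matrix_vector)

text \<open>Evaluating (w_j, J v_k) from either side gives the factor \<open>lam j\<close> or
  \<open>lam k\<close>; distinct eigenvalues then force the off-diagonal products to vanish.\<close>

lemma biorthogonal: "w j \<bullet> v k = (if j = k then 1 else 0)"
proof -
  have "lam j * (w j \<bullet> v k) = lam k * (w j \<bullet> v k)"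
    using w_J[of j "v k"] by (auto simp: right)
  then show ?thesis
    by (cases "j = k") (auto simp: w_v inj_eq[OF inj_lam])
qed

lemma eigenvalue_lam: "eigenvalue J (lam j)"
  unfolding eigenvalue_def eigenvector_def
  using right[of j] v_v[of j] by (intro exI[of _ "v j"]) (auto simp: scalar_mult_eq_scaleR)

text \<open>The left eigenvectors span, so one of them is nonzero on the real or imaginary part of
  any eigenvector, and \<open>left_functional_dichotomy\<close> identifies the eigenvalue.\<close>

lemma complex_eigenvalue_iff:
  "eigenvalue (complex_matrix J) \<mu> \<longleftrightarrow> (\<exists>j. \<mu> = complex_of_real (lam j))"
proof
  assume "eigenvalue (complex_matrix J) \<mu>"
  then obtain p q where pq: "p \<noteq> 0 \<or> q \<noteq> 0"
      "J *v p = Re \<mu> *\<^sub>R p - Im \<mu> *\<^sub>R q" "J *v q = Im \<mu> *\<^sub>R p + Re \<mu> *\<^sub>R q"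
    unfolding eigenvalue_complex_matrix_iff by blast
  then obtain j where "w j \<bullet> p \<noteq> 0 \<or> w j \<bullet> q \<noteq> 0"
    using orthogonal_family_zero[OF inj_w indep_w] by blast
  then have "Re \<mu> = lam j \<and> Im \<mu> = 0"
    using left_functional_dichotomy[of "lam j" "w j \<bullet> p" "Re \<mu>" "Im \<mu>" "w j \<bullet> q"]
      w_J[of j p] w_J[of j q] pq(2,3) by (auto simp: inner_diff_right inner_add_right)
  then show "\<exists>j. \<mu> = complex_of_real (lam j)"
    by (auto simp: complex_eq_iff)
qed (auto intro: eigenvalue_complex_matrix_of_real eigenvalue_lam)

lemma eigenvalue_iff: "eigenvalue J r \<longleftrightarrow> (\<exists>j. r = lam j)"
  using eigenvalue_complex_matrix_of_real[of J r] complex_eigenvalue_iff eigenvalue_lam by auto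

text \<open>The matrix with columns \<open>v c\<close> diagonalizes J, and by biorthogonality the
  matrix with rows \<open>w r\<close> is its inverse.\<close>

lemma order_charpoly: "order (complex_of_real (lam i)) (charpoly (complex_matrix J)) = 1"
proof -
  let ?V = "\<chi> r c. complex_of_real (v c $ r)" and ?U = "\<chi> r c. complex_of_real (w r $ c)"
  have "(\<Sum>k\<in>UNIV. J $ r $ k * v c $ k) = lam c * v c $ r" for r c
    using arg_cong[OF right[of c], of "\<lambda>x. x $ r"] by (simp add: matrix_vector_mult_def)
  then have "(\<Sum>k\<in>UNIV. complex_of_real (J $ r $ k) * complex_of_real (v c $ k)) =
      complex_of_real (lam c) * complex_of_real (v c $ r)" for r c
    by (simp flip: of_real_mult of_real_sum)
  then have "complex_matrix J ** ?V = ?V ** (\<chi> i j. if i = j then complex_of_real (lam i) else 0)"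
    by (simp add: vec_eq_iff matrix_matrix_mult_def complex_matrix_def if_distrib mult.commute
        cong: if_cong)
  moreover have "(\<Sum>k\<in>UNIV. complex_of_real (w r $ k) * complex_of_real (v c $ k)) = of_bool (r = c)" for r c
    using biorthogonal[of r c] by (simp add: inner_vec_def flip: of_real_mult of_real_sum)
  then have "?U ** ?V = mat 1"
    by (simp add: vec_eq_iff matrix_matrix_mult_def mat_def)
  ultimately have "charpoly (complex_matrix J) = (\<Prod>i\<in>UNIV. [:- complex_of_real (lam i), 1:])"
    by (rule charpoly_diagonalizable)
  moreover have "inj (\<lambda>i. complex_of_real (lam i))"
    using inj_lam by (simp add: inj_def)
  ultimately show ?thesis
    using order_prod_distinct_linear[of "\<lambda>i. complex_of_real (lam i)" i] by simp
qed

text \<open>The complex spectrum consists exactly of the values \<open>lam j\<close>, and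
  \<open>order_charpoly\<close> makes the multiplicity clause automatic.\<close>

lemma index1_saddle_iff:
  assumes "jacobian F (at x) = J" and "F x = 0"
  shows "index1_saddle UNIV F x \<longleftrightarrow> (\<exists>i. 0 < lam i \<and> (\<forall>j. j \<noteq> i \<longrightarrow> lam j < 0))"
proof -
  have spectrum: "(\<exists>j. \<mu> = complex_of_real (lam j)) \<longleftrightarrow> \<mu> \<in> range (\<lambda>i. complex_of_real (lam i))" for \<mu>
    by auto
  have "index1_saddle UNIV F x \<longleftrightarrow>
      (\<exists>\<mu>\<in>range (\<lambda>i. complex_of_real (lam i)). 0 < Re \<mu> \<and> order \<mu> (charpoly (complex_matrix J)) = 1 \<and>
        (\<forall>\<nu>\<in>range (\<lambda>j. complex_of_real (lam j)). \<nu> \<noteq> \<mu> \<longrightarrow> Re \<nu> < 0))"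
    unfolding index1_saddle_def assms(1) Let_def complex_eigenvalue_iff spectrum fixed_point_def
    using assms(2) by blast
  then show ?thesis
    using order_charpoly inj_lam by (simp add: inj_eq)
qed

lemma gad_fixed_point:
  assumes "jacobian F (at x) = J" and "F x = 0"
  shows "fixed_point gad_domain (gad F) (join3 x (v i) (w i))"
proof -
  show ?thesis
    using assms left[of i]
    by (simp add: join3_zero fixed_point_def gad_domain_def gad_def Let_def right v_v w_v del: transpose_matrix_vector)
qed

text \<open>For necessity the x block suffices: its eigenvalues already carry all the required
  signs. For sufficiency, an eigenvector whose eigenvalue has nonnegative real part is shown to have
  vanishing x, v and w components, in this order.\<close>

lemma gad_linearly_stable_iff:
  assumes F: "C_k 3 F" and J: "jacobian F (at x) = J" and F0: "F x = 0"
  shows "linearly_stable gad_domain (gad F) (join3 x (v i) (w i)) \<longleftrightarrow>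
    0 < lam i \<and> (\<forall>j. j \<noteq> i \<longrightarrow> lam j < 0)"
proof -
  let ?M = "jacobian (gad F) (at (join3 x (v i) (w i)))"
  obtain H K :: "real^'n \<Rightarrow> real^'n" where HK0: "H 0 = 0" "K 0 = 0"
    and deriv: "(gad F has_derivative (\<lambda>d. join3
        (J *v x_part d - (2 * lam i * (w i \<bullet> x_part d)) *\<^sub>R v i)
        (H (x_part d) + J *v v_part d
          - (lam i * (v_part d \<bullet> v i) + v i \<bullet> (J *v v_part d)) *\<^sub>R v i - lam i *\<^sub>R v_part d)
        (K (x_part d)
          - (2 * lam i * (w i \<bullet> v_part d) - lam i * (v_part d \<bullet> v i) - v i \<bullet> (J *v v_part d)) *\<^sub>R w i
          + transpose J *v w_part d - (2 * lam i * (w_part d \<bullet> v i)) *\<^sub>R w i - lam i *\<^sub>R w_part d)))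
      (at (join3 x (v i) (w i)))"
    by (rule gad_has_derivative_at_eigenvectors[OF F F0, unfolded J, OF right left v_v w_v]) (rule that)
  have "gad F differentiable (at (join3 x (v i) (w i)))"
    using deriv by (rule differentiableI)
  from this[unfolded jacobian_works] have M: "(*v) ?M = (\<lambda>d. join3
        (J *v x_part d - (2 * lam i * (w i \<bullet> x_part d)) *\<^sub>R v i)
        (H (x_part d) + J *v v_part d
          - (lam i * (v_part d \<bullet> v i) + v i \<bullet> (J *v v_part d)) *\<^sub>R v i - lam i *\<^sub>R v_part d)
        (K (x_part d)
          - (2 * lam i * (w i \<bullet> v_part d) - lam i * (v_part d \<bullet> v i) - v i \<bullet> (J *v v_part d)) *\<^sub>R w i
          + transpose J *v w_part d - (2 * lam i * (w_part d \<bullet> v i)) *\<^sub>R w i - lam i *\<^sub>R w_part d))"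
    by (rule has_derivative_unique[OF _ deriv])


  \<comment> \<open>Left eigenvectors of the diagonal blocks; each block is isolated by restricting to vectors whose
    earlier components vanish.\<close>
  have x_row: "join3 (w j) 0 0 \<bullet> (?M *v d) =
      (if j = i then - lam i else lam j) * (join3 (w j) 0 0 \<bullet> d)" for j d
    by (simp add: M inner_join3 inner_diff_right w_J biorthogonal)
  have v_row: "join3 0 (w j) 0 \<bullet> (?M *v d) = (lam j - lam i) * (join3 0 (w j) 0 \<bullet> d)"
    if "j \<noteq> i" "x_part d = 0" for j d
    using that by (simp add: M HK0 inner_join3 inner_diff_right w_J biorthogonal algebra_simps)
  \<comment> \<open>The term (v_i, J d_v) couples this row to the other directions, since the
    \<open>v j\<close> need not be mutually orthogonal. On multiples of \<open>v i\<close> the row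
    reduces to a factor: the two terms of the derivative of alpha contribute - \<open>lam i\<close>
    each.\<close>
  have v_row_i: "join3 0 (w i) 0 \<bullet> (?M *v d) = - 2 * lam i * (join3 0 (w i) 0 \<bullet> d)"
    if "x_part d = 0" "v_part d = c *\<^sub>R v i" for d c
    using that by (simp add: M HK0 inner_join3 inner_diff_right w_J biorthogonal
        matrix_vector_mult_scaleR right v_v)
  have w_row: "join3 0 0 (v j) \<bullet> (?M *v d) =
      (if j = i then - 2 * lam i else lam j - lam i) * (join3 0 0 (v j) \<bullet> d)"
    if "x_part d = 0" "v_part d = 0" for j d
    using that biorthogonal[of i j] inner_commute[of "v j" "w i"] inner_commute[of "w_part d" "v i"]
    by (simp add: M HK0 inner_join3 inner_diff_right v_Jt left_diff_distrib
        del: transpose_matrix_vector)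
  show ?thesis
  proof
    assume stable: "linearly_stable gad_domain (gad F) (join3 x (v i) (w i))"
    have signs: "(if j = i then - lam i else lam j) < 0" for j
    proof -
      have "join3 (w j) 0 0 \<bullet> join3 (v j) 0 0 \<noteq> (0 :: real)"
        by (simp add: inner_join3 w_v)
      then have "join3 (w j) 0 0 \<noteq> 0"
        by fastforce
      \<comment> \<open>\<open>x_row\<close> holds for every \<open>d\<close>, so its vector is a
        left eigenvector of the full matrix.\<close>
      then have "eigenvalue ?M (if j = i then - lam i else lam j)"
        using x_row by (rule eigenvalue_from_left)
      then have "Re (complex_of_real (if j = i then - lam i else lam j)) < 0"
        using stable eigenvalue_complex_matrix_of_real unfolding linearly_stable_def by blast
      then show ?thesis
        by simp
    qed
    show "0 < lam i \<and> (\<forall>j. j \<noteq> i \<longrightarrow> lam j < 0)"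
      using signs[of i] signs by (metis neg_less_0_iff_less)
  next
    assume sign: "0 < lam i \<and> (\<forall>j. j \<noteq> i \<longrightarrow> lam j < 0)"
    then have neg: "lam j < lam i" if "j \<noteq> i" for j
      using that by force
    have "Re \<mu> < 0" if "eigenvalue (complex_matrix ?M) \<mu>" for \<mu>
    proof (rule ccontr)
      assume nonneg: "\<not> Re \<mu> < 0"
      obtain p q where pq: "p \<noteq> 0 \<or> q \<noteq> 0"
          "?M *v p = Re \<mu> *\<^sub>R p - Im \<mu> *\<^sub>R q" "?M *v q = Im \<mu> *\<^sub>R p + Re \<mu> *\<^sub>R q"
        using \<open>eigenvalue (complex_matrix ?M) \<mu>\<close> unfolding eigenvalue_complex_matrix_iff by blast
      \<comment> \<open>A negative \<open>r\<close> cannot equal an eigenvalue with nonnegative real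
        part, so the dichotomy leaves only vanishing. The relation is needed just on
        \<open>p\<close> and \<open>q\<close>, which permits the restricted rows.\<close>
      have vanish: "l \<bullet> p = 0 \<and> l \<bullet> q = 0"
        if "r < 0" "l \<bullet> (?M *v p) = r * (l \<bullet> p)" "l \<bullet> (?M *v q) = r * (l \<bullet> q)" for l r
        using left_functional_dichotomy[of r "l \<bullet> p" "Re \<mu>" "Im \<mu>" "l \<bullet> q"] that nonneg
        by (simp add: pq(2,3) inner_diff_right inner_add_right)
      have "w j \<bullet> x_part p = 0 \<and> w j \<bullet> x_part q = 0" for j
        using vanish[OF _ x_row x_row, of j] sign by (auto simp: inner_join3 split: if_splits)
      then have x0: "x_part p = 0" "x_part q = 0"
        by (blast intro: orthogonal_family_zero[OF inj_w indep_w])+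
      have v_off: "w j \<bullet> v_part p = 0 \<and> w j \<bullet> v_part q = 0" if "j \<noteq> i" for j
        using vanish[OF _ v_row[OF that x0(1)] v_row[OF that x0(2)]] neg[OF that] by (simp add: inner_join3)
      \<comment> \<open>Removing the \<open>v i\<close> component leaves a vector orthogonal to all
        \<open>w j\<close>. Thus both v parts are multiples of \<open>v i\<close>, as
        \<open>v_row_i\<close> demands.\<close>
      then have "w j \<bullet> (v_part p - (w i \<bullet> v_part p) *\<^sub>R v i) = 0"
        "w j \<bullet> (v_part q - (w i \<bullet> v_part q) *\<^sub>R v i) = 0" for j
        by (cases "j = i"; simp add: inner_diff_right biorthogonal)+
      then have "v_part p - (w i \<bullet> v_part p) *\<^sub>R v i = 0" "v_part q - (w i \<bullet> v_part q) *\<^sub>R v i = 0"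
        by (blast intro: orthogonal_family_zero[OF inj_w indep_w])+
      then have v_span: "v_part p = (w i \<bullet> v_part p) *\<^sub>R v i" "v_part q = (w i \<bullet> v_part q) *\<^sub>R v i"
        by simp_all
      have "w i \<bullet> v_part p = 0 \<and> w i \<bullet> v_part q = 0"
        using vanish[OF _ v_row_i[OF x0(1) v_span(1)] v_row_i[OF x0(2) v_span(2)]] sign
        by (simp add: inner_join3)
      then have v0: "v_part p = 0" "v_part q = 0"
        using v_span by simp_all
      have "v j \<bullet> w_part p = 0 \<and> v j \<bullet> w_part q = 0" for j
        using vanish[OF _ w_row[OF x0(1) v0(1)] w_row[OF x0(2) v0(2)], of j] sign neg[of j]
        by (auto simp: inner_join3 split: if_splits)
      then have w0: "w_part p = 0" "w_part q = 0"
        by (blast intro: orthogonal_family_zero[OF inj_v indep_v])+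
      have "p = 0" "q = 0"
        using join3_parts[of p] join3_parts[of q] by (simp_all add: x0 v0 w0 join3_zero)
      with pq(1) show False
        by blast
    qed
    then show "linearly_stable gad_domain (gad F) (join3 x (v i) (w i))"
      unfolding linearly_stable_def using gad_fixed_point[OF J F0] by blast
  qed
qed

end

section \<open>Normalized fixed points of the GAD and assembly of the theorem\<close>

lemma gad_fixed_point_imp:
  fixes x v w :: "real^'n"
  assumes "fixed_point gad_domain (gad F) (join3 x v w)" and vv: "v \<bullet> v = 1" and vw: "v \<bullet> w = 1"
  shows "\<exists>l. eigenvector (jacobian F (at x)) l v \<and> left_eigenvector (jacobian F (at x)) l w"
    and "fixed_point UNIV F x"
proof -
  let ?J = "jacobian F (at x)" and ?l = "v \<bullet> (jacobian F (at x) *v v)"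
  have "gad F (join3 x v w) = 0"
    using assms(1) by (simp add: fixed_point_def)
  then have "x_part (gad F (join3 x v w)) = 0" "v_part (gad F (join3 x v w)) = 0"
      "w_part (gad F (join3 x v w)) = 0"
    by (simp_all add: x_part_def v_part_def w_part_def vec_eq_iff)
  then have x: "F x = (2 * (F x \<bullet> w)) *\<^sub>R v" and v: "?J *v v = ?l *\<^sub>R v"
    and w: "transpose ?J *v w = (2 * (w \<bullet> (?J *v v)) - ?l) *\<^sub>R w"
    using vw by (simp_all add: gad_def Let_def inner_commute del: transpose_matrix_vector)
  \<comment> \<open>Pairing the x equation with \<open>w\<close> gives (F, w) = 2 (F, w), so the
    reflection term vanishes and F x = 0.\<close>
  have "F x \<bullet> w = (2 * (F x \<bullet> w)) *\<^sub>R v \<bullet> w"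
    using x by (rule arg_cong)
  then have "F x \<bullet> w = 0"
    unfolding inner_scaleR_left vw by linarith
  then show "fixed_point UNIV F x"
    using x unfolding fixed_point_def by (metis UNIV_I mult_zero_right scaleR_zero_left)
  \<comment> \<open>Pairing the v equation with \<open>w\<close> gives (w, Jv) = alpha, hence beta =
    2 alpha - alpha = alpha: both eigenvalues agree.\<close>
  have "w \<bullet> (?J *v v) = w \<bullet> ?l *\<^sub>R v"
    using v by (rule arg_cong)
  then have "w \<bullet> (?J *v v) = ?l"
    unfolding inner_scaleR_right inner_commute[of w v] vw by linarith
  then have "transpose ?J *v w = ?l *\<^sub>R w"
    using w by (metis add_diff_cancel_right' mult_2)
  moreover have "v \<noteq> 0" "w \<noteq> 0"
    using vv vw by auto
  ultimately show "\<exists>l. eigenvector ?J l v \<and> left_eigenvector ?J l w"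
    using v unfolding left_eigenvector_def eigenvector_def scalar_mult_eq_scaleR by blast
qed

theorem mainTheorem1:
  fixes F :: "real^'n \<Rightarrow> real^'n"
  assumes "C_k 3 F"
  shows
    "(\<forall>x v w :: real^'n.
        fixed_point gad_domain (gad F) (join3 x v w) \<and> v \<bullet> v = 1 \<and> v \<bullet> w = 1 \<longrightarrow>
          (\<exists>l::real. eigenvector (jacobian F (at x)) l v \<and>
                     left_eigenvector (jacobian F (at x)) l w) \<and>
          fixed_point UNIV F x)
     \<and>
     (\<forall>(xs :: real^'n) (lam :: 'n \<Rightarrow> real) (v :: 'n \<Rightarrow> real^'n) (w :: 'n \<Rightarrow> real^'n).
        fixed_point UNIV F xs \<and>
        inj lam \<and>
        inj v \<and> independent (range v) \<and>
        inj w \<and> independent (range w) \<and>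
        (\<forall>i. eigenvector (jacobian F (at xs)) (lam i) (v i)) \<and>
        (\<forall>i. left_eigenvector (jacobian F (at xs)) (lam i) (w i)) \<and>
        (\<forall>i. v i \<bullet> v i = 1 \<and> w i \<bullet> v i = 1) \<longrightarrow>
          (\<forall>i. fixed_point gad_domain (gad F) (join3 xs (v i) (w i))) \<and>
          (\<forall>i. linearly_stable gad_domain (gad F) (join3 xs (v i) (w i)) \<longleftrightarrow>
                 index1_saddle UNIV F xs \<and>
                 (\<forall>\<mu>::real. eigenvalue (jacobian F (at xs)) \<mu> \<and> \<mu> > 0 \<longleftrightarrow> \<mu> = lam i)) \<and>
          ((\<exists>i. linearly_stable gad_domain (gad F) (join3 xs (v i) (w i))) \<longleftrightarrow>
             index1_saddle UNIV F xs))"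
proof (intro conjI allI impI, goal_cases)
  case (1 x v w)
  then show ?case
    using gad_fixed_point_imp(1) by blast
next
  case (2 x v w)
  then show ?case
    using gad_fixed_point_imp(2) by blast
next
  case (3 xs lam v w i)
  then interpret biorthonormal_eigenbasis "jacobian F (at xs)" lam v w
    unfolding biorthonormal_eigenbasis_def left_eigenvector_def eigenvector_def scalar_mult_eq_scaleR
    by blast
  have F0: "F xs = 0"
    using 3 unfolding fixed_point_def by blast
  then show ?case
    by (rule gad_fixed_point[OF refl])
next
  case (4 xs lam v w i)
  then interpret biorthonormal_eigenbasis "jacobian F (at xs)" lam v w
    unfolding biorthonormal_eigenbasis_def left_eigenvector_def eigenvector_def scalar_mult_eq_scaleR
    by blast
  have F0: "F xs = 0"
    using 4 unfolding fixed_point_def by blast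
  have "(\<forall>\<mu>. eigenvalue (jacobian F (at xs)) \<mu> \<and> 0 < \<mu> \<longleftrightarrow> \<mu> = lam i) \<longleftrightarrow>
      0 < lam i \<and> (\<forall>j. 0 < lam j \<longrightarrow> lam j = lam i)"
    unfolding eigenvalue_iff by blast
  \<comment> \<open>The index-1 witness \<open>k\<close> must be \<open>i\<close>, because
    \<open>lam i\<close> is positive and all values other than \<open>lam k\<close> are
    negative.\<close>
  moreover have "0 < lam i \<and> (\<forall>j. j \<noteq> i \<longrightarrow> lam j < 0) \<longleftrightarrow>
      (\<exists>k. 0 < lam k \<and> (\<forall>j. j \<noteq> k \<longrightarrow> lam j < 0)) \<and> 0 < lam i \<and> (\<forall>j. 0 < lam j \<longrightarrow> j = i)"
    by (intro iffI; elim conjE exE) (meson less_asym, metis)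
  ultimately show ?case
    unfolding gad_linearly_stable_iff[OF assms refl F0] index1_saddle_iff[OF refl F0]
      inj_eq[OF inj_lam] by (rule ssubst)
next
  case (5 xs lam v w)
  then interpret biorthonormal_eigenbasis "jacobian F (at xs)" lam v w
    unfolding biorthonormal_eigenbasis_def left_eigenvector_def eigenvector_def scalar_mult_eq_scaleR
    by blast
  have F0: "F xs = 0"
    using 5 unfolding fixed_point_def by blast
  show ?case
    unfolding gad_linearly_stable_iff[OF assms refl F0] index1_saddle_iff[OF refl F0] ..
qed

end
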